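(* Let $Q=\{x\in\mathbb{R}^n\mid Ax\le b\}$ be a nonempty polytope, let $\psi:\mathbb{R}^n\to(-\infty,\infty]$ be proper and convex with $\mathrm{relint}(\mathrm{dom}\,\psi)\cap Q\neq\emptyset$, and let $\varepsilon\ge 0$. Suppose that $\partial\psi(z)\cap N(z)\ne\emptyset$ for each vertex $z\in\mathrm{vert}(Q)$. Choose any $v_z\in\partial\psi(z)\cap N(z)$ for each vertex $z$, and define $B=\max\{\|v_z\|\mid z\in\mathrm{vert}(Q)\}$. Then $$\mathbb{P}[\mathrm{ER}^c(\varepsilon)]\ \le\ 1-\exp\Big(-\tfrac12\varepsilon^2B^2-\varepsilon B\sqrt n\Big)\ \le\ \tfrac12\varepsilon^2B^2+\varepsilon B\sqrt n,$$ and the regularization threshold $\overline\varepsilon$ satisfies $$\mathbb{E}\,\overline\varepsilon\ \ge\ \frac{1-e^{-4n}}{2B\sqrt n}.$$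
   Context: A polytope is a bounded polyhedron; $\mathrm{vert}(Q)$ is its set of vertices. $N(x)=\{v\in\mathbb{R}^n\mid v\cdot(y-x)\le 0\ \text{for all } y\in Q\}$ is the normal cone to $Q$ at $x\in Q$. Convention: for $\varepsilon>0$, $\varepsilon\psi$ is the usual scalar multiple; for $\varepsilon=0$, $\varepsilon\psi$ denotes the indicator function $\delta_{\mathrm{dom}\,\psi}$ (equal to $0$ on $\mathrm{dom}\,\psi$ and $+\infty$ elsewhere). $\partial$ is the convex subdifferential. Let $g\sim\mathcal N(0,I_n)$. (LP): minimize $-g\cdot x$ over $x\in Q$. $(P_\varepsilon)$: minimize $-g\cdot x+(\varepsilon\psi)(x)$ over $x\in Q$. $\mathrm{Sol}(\cdot)$ denotes the solution set. With probability 1, (LP) has a unique solution $z^\star$, a vertex of $Q$. $\mathrm{ER}(\varepsilon)$ is the event that $z^\star$ is also a solution of $(P_\varepsilon)$; $\mathrm{ER}^c(\varepsilon)$ is its complement. The regularization threshold is the $[0,\infty]$-valued random quantity $$\overline\varepsilon=\sup\{\varepsilon\ge 0\mid \mathrm{Sol}(P_{\varepsilon'})\subseteq\mathrm{Sol}(\mathrm{LP})\ \text{for all }\varepsilon'\in[0,\varepsilon)\}.$$ If $B=0$ the right-hand side of the last bound is read as $+\infty$. *)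

theory Defs
  imports "HOL-Probability.Probability"
begin

definition vert :: "'a::real_vector set \<Rightarrow> 'a set" where
  "vert Q = {z. z extreme_point_of Q}"

definition normal_cone :: "'a::real_inner set \<Rightarrow> 'a \<Rightarrow> 'a set" where
  "normal_cone Q x = {v. \<forall>y\<in>Q. v \<bullet> (y - x) \<le> 0}"


section \<open>Extended-real-valued convex functions\<close>

definition eff_dom :: "('a \<Rightarrow> ereal) \<Rightarrow> 'a set" where
  "eff_dom \<psi> = {x. \<psi> x < \<infinity>}"

definition proper_fun :: "('a \<Rightarrow> ereal) \<Rightarrow> bool" where
  "proper_fun \<psi> \<longleftrightarrow> (\<forall>x. \<psi> x \<noteq> -\<infinity>) \<and> eff_dom \<psi> \<noteq> {}"

text \<open>Convexity as convexity of the epigraph; the library's \<open>convex_on\<close> covers only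
  real-valued functions.\<close>

definition convex_fun :: "('a::real_vector \<Rightarrow> ereal) \<Rightarrow> bool" where
  "convex_fun \<psi> \<longleftrightarrow> convex {(x, t :: real). \<psi> x \<le> ereal t}"

text \<open>For proper \<open>\<psi>\<close> this set is empty whenever \<open>\<psi> z = \<infinity>\<close>.\<close>

definition subdiff :: "('a::real_inner \<Rightarrow> ereal) \<Rightarrow> 'a \<Rightarrow> 'a set" where
  "subdiff \<psi> z = {v. \<forall>y. \<psi> z + ereal (v \<bullet> (y - z)) \<le> \<psi> y}"

text \<open>Plain \<open>ereal\<close> multiplication has \<open>0 * \<infinity> = 0\<close>; for \<open>\<epsilon> = 0\<close> we want the indicator
  function of the effective domain instead.\<close>

definition scale_fun :: "real \<Rightarrow> ('a \<Rightarrow> ereal) \<Rightarrow> 'a \<Rightarrow> ereal" where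
  "scale_fun \<epsilon> \<psi> x =
     (if \<epsilon> = 0 then (if x \<in> eff_dom \<psi> then 0 else \<infinity>) else ereal \<epsilon> * \<psi> x)"


section \<open>The linear program and its regularization\<close>

definition Sol_LP :: "'a::real_inner set \<Rightarrow> 'a \<Rightarrow> 'a set" where
  "Sol_LP Q c = {x. is_arg_min (\<lambda>x. - (c \<bullet> x)) (\<lambda>x. x \<in> Q) x}"

definition Sol_P :: "'a::real_inner set \<Rightarrow> ('a \<Rightarrow> ereal) \<Rightarrow> real \<Rightarrow> 'a \<Rightarrow> 'a set" where
  "Sol_P Q \<psi> \<epsilon> c =
     {x. is_arg_min (\<lambda>x. ereal (- (c \<bullet> x)) + scale_fun \<epsilon> \<psi> x) (\<lambda>x. x \<in> Q) x}"

text \<open>Outcomes for which the linear program has several solutions, so that the vertex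
  \<open>z\<^sup>\<star>\<close> is not defined, do not belong to the event.\<close>

definition ER :: "'w measure \<Rightarrow> 'a::real_inner set \<Rightarrow> ('a \<Rightarrow> ereal) \<Rightarrow> ('w \<Rightarrow> 'a) \<Rightarrow> real \<Rightarrow> 'w set"
  where "ER M Q \<psi> g \<epsilon> =
     {\<omega> \<in> space M. \<exists>z. Sol_LP Q (g \<omega>) = {z} \<and> z \<in> Sol_P Q \<psi> \<epsilon> (g \<omega>)}"

definition threshold :: "'a::real_inner set \<Rightarrow> ('a \<Rightarrow> ereal) \<Rightarrow> 'a \<Rightarrow> ennreal" where
  "threshold Q \<psi> c =
     Sup {ennreal \<epsilon> | \<epsilon>. 0 \<le> \<epsilon> \<and> (\<forall>\<epsilon>'\<in>{0..<\<epsilon>}. Sol_P Q \<psi> \<epsilon>' c \<subseteq> Sol_LP Q c)}"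


section \<open>The standard Gaussian distribution\<close>

definition std_gaussian :: "'w measure \<Rightarrow> ('w \<Rightarrow> real ^ 'n) \<Rightarrow> bool" where
  "std_gaussian M g \<longleftrightarrow>
     distributed M lborel g (\<lambda>x. ennreal (\<Prod>i\<in>UNIV. std_normal_density (x $ i)))"

end

theory Submission
  imports Defs
begin

text \<open>
  The interiors \<open>C\<^sub>z\<close> of the normal cones at the vertices \<open>z\<close> of \<open>Q\<close> are disjoint and cover the
  space up to a null set. If \<open>g - \<epsilon> v\<^sub>z \<in> C\<^sub>z\<close>, then \<open>z\<close> solves the regularized program, and since
  \<open>v\<^sub>z\<close> is itself normal at \<open>z\<close>, also \<open>g \<in> C\<^sub>z\<close>, so \<open>z\<close> is the unique solution of the linear
  program. Translating the Gaussian density bounds the total probability of these events below by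
  \<open>exp (- \<epsilon>\<^sup>2 B\<^sup>2 / 2) E exp (- \<epsilon> B \<parallel>g\<parallel>)\<close>, hence by \<open>exp (- \<epsilon>\<^sup>2 B\<^sup>2 / 2 - \<epsilon> B \<surd>n)\<close>. Exactness at
  \<open>\<epsilon>\<close> forces the threshold to be at least \<open>\<epsilon>\<close>, so integrating this bound over \<open>\<epsilon>\<close> bounds the
  expected threshold from below; on \<open>\<epsilon> B \<le> 2 \<surd>n\<close> the integrand is at least \<open>exp (- 2 \<epsilon> B \<surd>n)\<close>.
\<close>

section \<open>Linear programs and their regularization\<close>

lemma mem_Sol_LP: "x \<in> Sol_LP Q c \<longleftrightarrow> x \<in> Q \<and> (\<forall>y\<in>Q. c \<bullet> y \<le> c \<bullet> x)"
  by (auto simp: Sol_LP_def is_arg_min_def not_less)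

lemma mem_Sol_P:
  "x \<in> Sol_P Q \<psi> \<epsilon> c \<longleftrightarrow> x \<in> Q \<and>
     (\<forall>y\<in>Q. ereal (- (c \<bullet> x)) + scale_fun \<epsilon> \<psi> x \<le> ereal (- (c \<bullet> y)) + scale_fun \<epsilon> \<psi> y)"
  by (auto simp: Sol_P_def is_arg_min_def not_less)

text \<open>For \<open>Q = convex hull V\<close> and a vertex \<open>z\<close>, this is the interior of the normal cone to \<open>Q\<close>
  at \<open>z\<close>.\<close>

definition opt_cone :: "'a::real_inner set \<Rightarrow> 'a \<Rightarrow> 'a set" where
  "opt_cone V z = {c. \<forall>z'\<in>V - {z}. c \<bullet> z' < c \<bullet> z}"

lemma opt_cone_measurable [measurable]:
  fixes V :: "'a::euclidean_space set"
  assumes "finite V"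
  shows "opt_cone V z \<in> sets borel"
proof -
  have "opt_cone V z = (\<Inter>z'\<in>V - {z}. {c. c \<bullet> z' < c \<bullet> z})"
    by (auto simp: opt_cone_def)
  moreover have "open \<dots>"
    using assms by (intro open_INT ballI open_Collect_less continuous_intros) auto
  ultimately show ?thesis by simp
qed

text \<open>A strict inequality plus a weak one stays strict: adding a vector normal at
  \<open>z\<close> keeps the cost in the open cone.\<close>

lemma opt_cone_shift:
  assumes c: "c - w \<in> opt_cone V z" and w: "\<And>z'. z' \<in> V \<Longrightarrow> w \<bullet> z' \<le> w \<bullet> z"
  shows "c \<in> opt_cone V z"
proof -
  have "c \<bullet> z' < c \<bullet> z" if z': "z' \<in> V - {z}" for z'
  proof -
    have "(c - w) \<bullet> z' < (c - w) \<bullet> z" using c z' by (simp add: opt_cone_def)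
    moreover have "w \<bullet> z' \<le> w \<bullet> z" using w z' by simp
    ultimately show ?thesis by (simp add: inner_diff_left)
  qed
  then show ?thesis by (simp add: opt_cone_def)
qed

text \<open>A point of the hull other than \<open>z\<close> puts positive weight on
  \<open>convex hull (V - {z})\<close>, and that hull lies in the open half-space of values below
  \<open>c \<bullet> z\<close>.\<close>

lemma Sol_LP_opt_cone:
  fixes V :: "'a::euclidean_space set"
  assumes z: "z \<in> V" and c: "c \<in> opt_cone V z"
  shows "Sol_LP (convex hull V) c = {z}"
proof -
  have le: "c \<bullet> y < c \<bullet> z \<or> y = z" if y: "y \<in> convex hull V" for y
  proof (cases "V - {z} = {}")
    case True
    then have "V = {z}" using z by auto
    then show ?thesis using y by simp
  next
    case False
    have "V = insert z (V - {z})" using z by auto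
    then have "y \<in> convex hull (insert z (V - {z}))" using y by simp
    then obtain s t w where st: "0 \<le> s" "0 \<le> t" "s + t = 1" "w \<in> convex hull (V - {z})"
      "y = s *\<^sub>R z + t *\<^sub>R w"
      unfolding convex_hull_insert[OF False] by auto
    have "convex hull (V - {z}) \<subseteq> {w. c \<bullet> w < c \<bullet> z}"
      using c by (intro hull_minimal convex_halfspace_lt) (auto simp: opt_cone_def)
    then have w: "c \<bullet> w < c \<bullet> z" using st by auto
    have s: "s = 1 - t" using st by simp
    show ?thesis
    proof (cases "t = 0")
      case True then show ?thesis using s st by simp
    next
      case False
      then have "t * (c \<bullet> w) < t * (c \<bullet> z)" using st w by simp
      moreover have "c \<bullet> y = (c \<bullet> z) - t * (c \<bullet> z) + t * (c \<bullet> w)"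
        unfolding st(5) s by (simp add: inner_add_right left_diff_distrib)
      ultimately show ?thesis by simp
    qed
  qed
  then show ?thesis
    using hull_inc[OF z, of convex] by (force simp: mem_Sol_LP)
qed

lemma Sol_LP_convex_hull_vertex:
  fixes V :: "'a::euclidean_space set"
  assumes "finite V" "V \<noteq> {}"
  obtains z where "z \<in> V" "z \<in> Sol_LP (convex hull V) c"
proof -
  have "Max ((\<bullet>) c ` V) \<in> (\<bullet>) c ` V" using assms by (intro Max_in) auto
  then obtain z where z: "z \<in> V" "Max ((\<bullet>) c ` V) = c \<bullet> z" by auto
  have "convex hull V \<subseteq> {y. c \<bullet> y \<le> c \<bullet> z}"
    using assms by (intro hull_minimal convex_halfspace_le) (auto simp: z(2)[symmetric])
  then have "z \<in> Sol_LP (convex hull V) c"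
    using hull_inc[OF z(1), of convex] by (auto simp: mem_Sol_LP)
  with z that show ?thesis by blast
qed

text \<open>Lets unique solvability be read off finitely many strict linear inequalities. Some point
  of \<open>V\<close> is always optimal, so a unique solution lies in \<open>V\<close> and strictly
  beats the other points of \<open>V\<close>.\<close>

lemma Sol_LP_eq_singleton_iff:
  fixes V :: "'a::euclidean_space set"
  assumes V: "finite V" "V \<noteq> {}"
  shows "Sol_LP (convex hull V) c = {z} \<longleftrightarrow> z \<in> V \<and> c \<in> opt_cone V z"
proof
  assume sol: "Sol_LP (convex hull V) c = {z}"
  obtain z0 where "z0 \<in> V" "z0 \<in> Sol_LP (convex hull V) c"
    using Sol_LP_convex_hull_vertex[OF V] .
  then have z: "z \<in> V" using sol by simp
  have "c \<bullet> z' < c \<bullet> z" if z': "z' \<in> V - {z}" for z'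
  proof (rule ccontr)
    assume "\<not> c \<bullet> z' < c \<bullet> z"
    moreover have "\<forall>y\<in>convex hull V. c \<bullet> y \<le> c \<bullet> z" using sol mem_Sol_LP by blast
    ultimately have "z' \<in> Sol_LP (convex hull V) c"
      using hull_inc[of z' V convex] z' by (force simp: mem_Sol_LP)
    then show False using sol z' by simp
  qed
  then show "z \<in> V \<and> c \<in> opt_cone V z" using z by (auto simp: opt_cone_def)
next
  assume "z \<in> V \<and> c \<in> opt_cone V z"
  then show "Sol_LP (convex hull V) c = {z}" by (simp add: Sol_LP_opt_cone)
qed

section \<open>Optimality in the regularized program and the threshold\<close>

lemma scale_fun_ereal: "\<psi> x = ereal p \<Longrightarrow> scale_fun t \<psi> x = ereal (t * p)"
  by (simp add: scale_fun_def eff_dom_def)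

text \<open>Includes \<open>t = 0\<close>, where the indicator convention replaces the product
  \<open>0 * \<infinity> = 0\<close>.\<close>

lemma scale_fun_PInf: "\<psi> x = \<infinity> \<Longrightarrow> 0 \<le> t \<Longrightarrow> scale_fun t \<psi> x = \<infinity>"
  by (simp add: scale_fun_def eff_dom_def)

text \<open>The subgradient inequality against a point of finite value excludes
  \<open>\<infinity>\<close>.\<close>

lemma subdiff_finite:
  assumes "proper_fun \<psi>" "v \<in> subdiff \<psi> z"
  obtains p where "\<psi> z = ereal p"
proof -
  obtain y where "\<psi> y < \<infinity>" using assms(1) by (auto simp: proper_fun_def eff_dom_def)
  moreover have "\<psi> z + ereal (v \<bullet> (y - z)) \<le> \<psi> y" using assms(2) by (simp add: subdiff_def)
  ultimately have "\<psi> z \<noteq> \<infinity>" by auto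
  moreover have "\<psi> z \<noteq> -\<infinity>" using assms(1) by (simp add: proper_fun_def)
  ultimately show ?thesis using that by (cases "\<psi> z") auto
qed

text \<open>Optimality of \<open>z\<close> for the cost \<open>c - t *\<^sub>R v\<close> and
  \<open>t\<close> times the subgradient inequality add up; the terms in \<open>v\<close>
  cancel.\<close>

lemma Sol_P_if_shifted_normal:
  assumes proper: "proper_fun \<psi>" and sub: "v \<in> subdiff \<psi> z" and t: "0 \<le> t"
    and z: "z \<in> Sol_LP Q (c - t *\<^sub>R v)"
  shows "z \<in> Sol_P Q \<psi> t c"
proof -
  obtain p where p: "\<psi> z = ereal p" using subdiff_finite[OF proper sub] .
  have "ereal (- (c \<bullet> z)) + scale_fun t \<psi> z \<le> ereal (- (c \<bullet> y)) + scale_fun t \<psi> y"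
    if y: "y \<in> Q" for y
  proof -
    have le: "(c - t *\<^sub>R v) \<bullet> y \<le> (c - t *\<^sub>R v) \<bullet> z" using z y by (simp add: mem_Sol_LP)
    have s: "\<psi> z + ereal (v \<bullet> (y - z)) \<le> \<psi> y" using sub by (simp add: subdiff_def)
    show ?thesis
    proof (cases "\<psi> y")
      case (real q)
      have "t * (p + v \<bullet> (y - z)) \<le> t * q"
        using s p real t by (intro mult_left_mono) auto
      then show ?thesis
        using le real p by (simp add: scale_fun_ereal algebra_simps)
    next
      case PInf
      then show ?thesis using t by (simp add: scale_fun_PInf)
    next
      case MInf
      then show ?thesis using proper by (simp add: proper_fun_def)
    qed
  qed
  then show ?thesis using z by (simp add: mem_Sol_P mem_Sol_LP)
qed

text \<open>For \<open>\<epsilon> < t\<close> the objective of the \<open>\<epsilon>\<close>-problem is a convex combination of the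
  \<open>t\<close>-regularized and the linear objective, with positive weight on the latter.\<close>

lemma Sol_P_subset_if_exact:
  assumes proper: "proper_fun \<psi>" and z: "\<psi> z = ereal p"
    and LP: "Sol_LP Q c = {z}" and P: "z \<in> Sol_P Q \<psi> t c"
    and e: "0 \<le> \<epsilon>" "\<epsilon> < t"
  shows "Sol_P Q \<psi> \<epsilon> c \<subseteq> {z}"
proof
  fix x assume x: "x \<in> Sol_P Q \<psi> \<epsilon> c"
  have zQ: "z \<in> Q" and xQ: "x \<in> Q" using x P by (simp_all add: mem_Sol_P)
  have x_le: "ereal (- (c \<bullet> x)) + scale_fun \<epsilon> \<psi> x \<le> ereal (- (c \<bullet> z)) + scale_fun \<epsilon> \<psi> z"
    using x zQ by (simp add: mem_Sol_P)
  have z_le: "ereal (- (c \<bullet> z)) + scale_fun t \<psi> z \<le> ereal (- (c \<bullet> x)) + scale_fun t \<psi> x"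
    using P xQ by (simp add: mem_Sol_P)
  have "\<psi> x \<noteq> \<infinity>" using x_le z e by (auto simp: scale_fun_PInf scale_fun_ereal)
  then obtain q where q: "\<psi> x = ereal q"
    using proper by (cases "\<psi> x") (auto simp: proper_fun_def)
  have 1: "c \<bullet> z - c \<bullet> x \<le> \<epsilon> * (p - q)"
    using x_le z q by (simp add: scale_fun_ereal algebra_simps)
  have 2: "t * (p - q) \<le> c \<bullet> z - c \<bullet> x"
    using z_le z q by (simp add: scale_fun_ereal algebra_simps)
  have 3: "c \<bullet> x \<le> c \<bullet> z" using LP xQ mem_Sol_LP[of z Q c] by auto
  show "x \<in> {z}"
  \<comment> \<open>If \<open>p > q\<close>, facts 1 and 2 contradict \<open>\<epsilon> < t\<close>;
    otherwise \<open>x\<close> does as well as \<open>z\<close> in the linear program, whose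
    solution is unique.\<close>
  proof (cases "p - q > 0")
    case True
    then have "\<epsilon> * (p - q) < t * (p - q)" using e by simp
    then show ?thesis using 1 2 by simp
  next
    case False
    then have "\<epsilon> * (p - q) \<le> 0" using e by (simp add: mult_nonneg_nonpos)
    then have "c \<bullet> x = c \<bullet> z" using 1 3 by simp
    then have "x \<in> Sol_LP Q c" using LP xQ mem_Sol_LP[of z Q c] mem_Sol_LP[of x Q c] by auto
    then show ?thesis using LP by simp
  qed
qed

text \<open>The half-open range in \<open>threshold\<close> admits \<open>t\<close> itself: at
  \<open>t\<close> the program may have further solutions, but below \<open>t\<close> it has none
  besides \<open>z\<close>.\<close>

lemma threshold_ge_if_exact:
  assumes "proper_fun \<psi>" "\<psi> z = ereal p" "Sol_LP Q c = {z}" "z \<in> Sol_P Q \<psi> t c" "0 \<le> t"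
  shows "ennreal t \<le> threshold Q \<psi> c"
proof -
  have "\<forall>\<epsilon>'\<in>{0..<t}. Sol_P Q \<psi> \<epsilon>' c \<subseteq> Sol_LP Q c"
    using Sol_P_subset_if_exact[OF assms(1-4)] assms(3) by simp
  then show ?thesis
    unfolding threshold_def using assms(5) by (intro Sup_upper) blast
qed

text \<open>Each comparison with a fixed \<open>y\<close> is a closed condition on \<open>c\<close>:
  a linear inequality where \<open>\<psi> y\<close> is finite, no condition where it is
  \<open>\<infinity>\<close>. Closedness survives the possibly uncountable intersection over
  \<open>Q\<close>.\<close>

lemma closed_Sol_P_coeffs:
  assumes proper: "proper_fun \<psi>" and z: "\<psi> z = ereal p" and t: "0 \<le> t"
  shows "closed {c. z \<in> Sol_P Q \<psi> t c}"
proof (cases "z \<in> Q")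
  case True
  have "closed {c. ereal (- (c \<bullet> z)) + scale_fun t \<psi> z \<le> ereal (- (c \<bullet> y)) + scale_fun t \<psi> y}" for y
  proof (cases "scale_fun t \<psi> y")
    case (real q)
    have "closed {c. - (c \<bullet> z) + t * p \<le> - (c \<bullet> y) + q}"
      by (intro closed_Collect_le continuous_intros)
    then show ?thesis using real z by (simp add: scale_fun_ereal)
  next
    case MInf
    then show ?thesis
      using proper t by (cases "\<psi> y") (auto simp: proper_fun_def scale_fun_def split: if_splits)
  qed simp
  then have "closed (\<Inter>y\<in>Q. {c. ereal (- (c \<bullet> z)) + scale_fun t \<psi> z
      \<le> ereal (- (c \<bullet> y)) + scale_fun t \<psi> y})"
    by blast
  moreover have "{c. z \<in> Sol_P Q \<psi> t c} = \<dots>" using True by (auto simp: mem_Sol_P)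
  ultimately show ?thesis by simp
qed (simp add: mem_Sol_P)

lemma ER_eq_vimage:
  fixes V :: "'a::euclidean_space set"
  assumes "finite V" "V \<noteq> {}"
  shows "ER M (convex hull V) \<psi> g t =
    g -` (\<Union>z\<in>V. opt_cone V z \<inter> {c. z \<in> Sol_P (convex hull V) \<psi> t c}) \<inter> space M"
  unfolding ER_def Sol_LP_eq_singleton_iff[OF assms] by auto

section \<open>The Gaussian measure\<close>

definition gauss_density :: "real ^ 'n \<Rightarrow> real" where
  "gauss_density x = (\<Prod>i\<in>UNIV. std_normal_density (x $ i))"

text \<open>The law of \<open>g\<close>, detached from the underlying probability space.\<close>

definition gauss :: "(real ^ 'n) measure" where
  "gauss = density lborel (\<lambda>x. ennreal (gauss_density x))"

lemma gauss_density_nonneg [simp]: "0 \<le> gauss_density x"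
  by (simp add: gauss_density_def prod_nonneg)

lemma gauss_density_measurable [measurable]: "gauss_density \<in> borel_measurable borel"
  unfolding gauss_density_def[abs_def] by measurable

lemma sets_gauss [simp, measurable_cong]: "sets gauss = sets borel"
  by (simp add: gauss_def)

lemma space_gauss [simp]: "space gauss = UNIV"
  by (simp add: gauss_def)

lemma gauss_density_add:
  "gauss_density (x + w) = exp (- (x \<bullet> w) - (norm w)\<^sup>2 / 2) * gauss_density x"
proof -
  have "std_normal_density (x $ i + w $ i)
      = exp (- (x $ i * w $ i) - (w $ i)\<^sup>2 / 2) * std_normal_density (x $ i)" for i
    by (simp add: std_normal_density_def exp_add[symmetric] power2_sum field_simps)
  then have "gauss_density (x + w)
      = exp (\<Sum>i\<in>UNIV. - (x $ i * w $ i) - (w $ i)\<^sup>2 / 2) * gauss_density x"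
    by (simp add: gauss_density_def prod.distrib exp_sum)
  also have "(\<Sum>i\<in>UNIV. - (x $ i * w $ i) - (w $ i)\<^sup>2 / 2) = - (x \<bullet> w) - (norm w)\<^sup>2 / 2"
    unfolding power2_norm_eq_inner
    by (simp add: inner_vec_def sum_subtractf sum_negf sum_divide_distrib power2_eq_square)
  finally show ?thesis .
qed

text \<open>The Cameron-Martin formula for a constant shift: translation invariance of Lebesgue
  measure moves the shift into the density.\<close>

lemma emeasure_gauss_translate:
  assumes [measurable]: "S \<in> sets borel"
  shows "emeasure gauss {x. x - w \<in> S}
    = (\<integral>\<^sup>+ x. ennreal (exp (- (x \<bullet> w) - (norm w)\<^sup>2 / 2)) * indicator S x \<partial>gauss)"
proof -
  have m: "{x. x - w \<in> S} \<in> sets borel" by measurable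
  have "emeasure gauss {x. x - w \<in> S}
      = (\<integral>\<^sup>+ x. ennreal (gauss_density x) * indicator {x. x - w \<in> S} x \<partial>lborel)"
    using m by (simp add: gauss_def emeasure_density)
  also have "\<dots> = (\<integral>\<^sup>+ x. ennreal (gauss_density x) * indicator {x. x - w \<in> S} x
      \<partial>distr lborel borel ((+) w))"
    by (simp add: lborel_distr_plus)
  also have "\<dots> = (\<integral>\<^sup>+ x. ennreal (gauss_density (x + w)) * indicator S x \<partial>lborel)"
    using m by (subst nn_integral_distr) (auto simp: add.commute indicator_def)
  also have "\<dots> = (\<integral>\<^sup>+ x. ennreal (gauss_density x) *
      (ennreal (exp (- (x \<bullet> w) - (norm w)\<^sup>2 / 2)) * indicator S x) \<partial>lborel)"
    by (simp add: gauss_density_add ennreal_mult' mult_ac)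
  also have "\<dots> = (\<integral>\<^sup>+ x. ennreal (exp (- (x \<bullet> w) - (norm w)\<^sup>2 / 2)) * indicator S x \<partial>gauss)"
    unfolding gauss_def by (subst nn_integral_density) auto
  finally show ?thesis .
qed

section \<open>Product integrals and second moments\<close>

lemma nn_integral_lborel_vec_prod:
  fixes f :: "'n::finite \<Rightarrow> real \<Rightarrow> real"
  assumes [measurable]: "\<And>i. f i \<in> borel_measurable borel" and nn: "\<And>i x. 0 \<le> f i x"
  shows "(\<integral>\<^sup>+ (x::real^'n). ennreal (\<Prod>i\<in>UNIV. f i (x $ i)) \<partial>lborel)
    = (\<Prod>i\<in>UNIV. \<integral>\<^sup>+ x. ennreal (f i x) \<partial>lborel)"
proof -
  \<comment> \<open>Recovers the index from a basis vector; the choice is unambiguous because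
    \<open>axis\<close> with entry 1 is injective.\<close>
  define F where "F = (\<lambda>b::real^'n. f (SOME i. b = axis i 1))"
  have F: "F (axis i 1) = f i" for i
    by (simp add: F_def axis_eq_axis)
  have B: "(Basis :: (real^'n) set) = range (\<lambda>i. axis i 1)"
    by (auto simp: Basis_vec_def)
  have inj: "inj (\<lambda>i::'n. axis i (1::real))" by (auto simp: inj_def axis_eq_axis)
  have "(\<integral>\<^sup>+ (x::real^'n). (\<Prod>b\<in>Basis. ennreal (F b (x \<bullet> b))) \<partial>lborel)
    = (\<Prod>b\<in>(Basis::(real^'n) set). \<integral>\<^sup>+ x. ennreal (F b x) \<partial>lborel)"
    by (rule nn_integral_lborel_prod) (auto simp: F_def nn)
  then show ?thesis
    by (simp add: B prod.reindex[OF inj] F inner_axis prod_ennreal nn)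
qed

lemma nn_integral_std_normal: "(\<integral>\<^sup>+ x. ennreal (std_normal_density x) \<partial>lborel) = 1"
  by (subst nn_integral_eq_integral) (auto)

lemma nn_integral_std_normal_square:
  "(\<integral>\<^sup>+ x. ennreal (x\<^sup>2 * std_normal_density x) \<partial>lborel) = 1"
proof -
  \<comment> \<open>The even moment of order 2, with value
    \<open>fact 2 / (2 * fact 1) = 1\<close>.\<close>
  have "has_bochner_integral lborel (\<lambda>x. std_normal_density x * x ^ (2 * 1))
      (fact (2 * 1) / (2 ^ 1 * fact 1))"
    by (rule std_normal_moment_even)
  then have "has_bochner_integral lborel (\<lambda>x. x\<^sup>2 * std_normal_density x) 1"
    by (simp add: mult.commute)
  then show ?thesis
    by (subst nn_integral_eq_integral) (auto simp: has_bochner_integral_iff)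
qed

lemma prob_space_gauss: "prob_space gauss"
proof
  show "emeasure gauss (space (gauss :: (real^'n) measure)) = 1"
    using nn_integral_lborel_vec_prod[of "\<lambda>_::'n. std_normal_density"]
    by (simp add: gauss_def emeasure_density gauss_density_def nn_integral_std_normal)
qed

lemma nn_integral_gauss_norm_square:
  "(\<integral>\<^sup>+ (x::real^'n). ennreal ((norm x)\<^sup>2) \<partial>gauss) = of_nat CARD('n)"
proof -
  have coord: "(\<integral>\<^sup>+ (x::real^'n). ennreal ((x $ i)\<^sup>2) \<partial>gauss) = 1" for i
  proof -
    \<comment> \<open>The square modifies only factor \<open>i\<close>, so the integrand remains a
      product over coordinates.\<close>
    let ?f = "\<lambda>j x. (if j = i then x\<^sup>2 * std_normal_density x else std_normal_density x)"
    have eq: "gauss_density x * (x $ i)\<^sup>2 = (\<Prod>j\<in>UNIV. ?f j (x $ j))" for x :: "real^'n"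
      unfolding gauss_density_def by (simp add: prod.remove[where x = i])
    have "(\<integral>\<^sup>+ (x::real^'n). ennreal ((x $ i)\<^sup>2) \<partial>gauss)
      = (\<integral>\<^sup>+ (x::real^'n). ennreal (\<Prod>j\<in>UNIV. ?f j (x $ j)) \<partial>lborel)"
      unfolding gauss_def
      by (subst nn_integral_density) (auto simp: ennreal_mult'[symmetric] eq)
    also have "\<dots> = (\<Prod>j\<in>UNIV. \<integral>\<^sup>+ x. ennreal (?f j x) \<partial>lborel)"
      by (intro nn_integral_lborel_vec_prod) auto
    also have "\<dots> = 1"
    proof (intro prod.neutral ballI)
      fix j
      show "(\<integral>\<^sup>+ x. ennreal (?f j x) \<partial>lborel) = 1"
        by (cases "j = i") (simp_all add: nn_integral_std_normal nn_integral_std_normal_square)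
    qed
    finally show ?thesis .
  qed
  have "(norm x)\<^sup>2 = (\<Sum>i\<in>UNIV. (x $ i)\<^sup>2)" for x :: "real^'n"
    unfolding power2_norm_eq_inner by (simp add: inner_vec_def power2_eq_square)
  then have "ennreal ((norm x)\<^sup>2) = (\<Sum>i\<in>UNIV. ennreal ((x $ i)\<^sup>2))" for x :: "real^'n"
    by simp
  then show ?thesis
    by (simp add: nn_integral_sum coord del: sum_ennreal)
qed

lemma integral_gauss_norm_square:
  shows "integrable gauss (\<lambda>x::real^'n. (norm x)\<^sup>2)"
    and "(\<integral>(x::real^'n). (norm x)\<^sup>2 \<partial>gauss) = CARD('n)"
proof -
  show "integrable gauss (\<lambda>x::real^'n. (norm x)\<^sup>2)"
    by (rule integrableI_nn_integral_finite[where x = "CARD('n)"])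
       (auto simp: nn_integral_gauss_norm_square ennreal_of_nat_eq_real_of_nat)
  show "(\<integral>(x::real^'n). (norm x)\<^sup>2 \<partial>gauss) = CARD('n)"
    by (subst integral_eq_nn_integral) (auto simp: nn_integral_gauss_norm_square)
qed

text \<open>The tangent of \<open>r \<mapsto> exp (- a r)\<close> at \<open>\<surd>n\<close> together with AM-GM,
  \<open>r \<le> (r\<^sup>2 / \<surd>n + \<surd>n) / 2\<close>, bounds the integrand below by an affine function of \<open>r\<^sup>2\<close>.\<close>

lemma nn_integral_gauss_exp_norm_ge:
  assumes a: "0 \<le> a"
  shows "ennreal (exp (- a * sqrt CARD('n))) \<le> (\<integral>\<^sup>+ (x::real^'n). ennreal (exp (- a * norm x)) \<partial>gauss)"
proof -
  interpret prob_space "gauss :: (real^'n) measure" by (rule prob_space_gauss)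
  define s where "s = sqrt (real CARD('n))"
  have s: "s > 0" "s\<^sup>2 = CARD('n)" by (auto simp: s_def)
  let ?l = "\<lambda>x::real^'n. exp (- a * s) * (1 - a * ((norm x)\<^sup>2 - s\<^sup>2) / (2 * s))"
  have le: "?l x \<le> exp (- a * norm x)" for x :: "real^'n"
  proof -
    have "2 * s * norm x \<le> (norm x)\<^sup>2 + s\<^sup>2" using sum_squares_bound[of "norm x" s] by (simp add: mult_ac)
    then have "norm x - s \<le> ((norm x)\<^sup>2 - s\<^sup>2) / (2 * s)"
      using s(1) by (simp add: field_simps power2_eq_square)
    then have "a * (norm x - s) \<le> a * ((norm x)\<^sup>2 - s\<^sup>2) / (2 * s)"
      using a mult_left_mono by fastforce
    then have "1 - a * ((norm x)\<^sup>2 - s\<^sup>2) / (2 * s) \<le> exp (- (a * (norm x - s)))"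
      using exp_ge_add_one_self[of "- (a * (norm x - s))"] by linarith
    then have "?l x \<le> exp (- a * s) * exp (- (a * (norm x - s)))"
      by (intro mult_left_mono) auto
    also have "\<dots> = exp (- a * norm x)" by (simp add: exp_add[symmetric] algebra_simps)
    finally show ?thesis .
  qed
  have int: "integrable gauss (\<lambda>x::real^'n. exp (- a * norm x))"
    using a by (intro integrable_const_bound[where B = 1]) auto
  \<comment> \<open>The correction term integrates to zero because the mean of
    \<open>(norm x)\<^sup>2\<close> is \<open>s\<^sup>2\<close>.\<close>
  have "(\<integral>(x::real^'n). ?l x \<partial>gauss) = exp (- a * s)"
    by (simp add: integral_gauss_norm_square s prob_space[simplified])
  moreover have "(\<integral>(x::real^'n). ?l x \<partial>gauss) \<le> (\<integral>(x::real^'n). exp (- a * norm x) \<partial>gauss)"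
    using le by (intro integral_mono int) (auto intro!: integrable_diff integrable_mult_right integral_gauss_norm_square integrable_divide_zero)
  ultimately show ?thesis
    unfolding s_def by (subst nn_integral_eq_integral[OF int]) auto
qed

section \<open>Gaussian measure of the cones\<close>

lemma AE_gauss_opt_cone:
  fixes V :: "(real ^ 'n) set"
  assumes V: "finite V" "V \<noteq> {}"
  shows "AE c in gauss. c \<in> (\<Union>z\<in>V. opt_cone V z)"
proof -
  \<comment> \<open>Ties between two points of \<open>V\<close> confine \<open>c\<close> to one of
    finitely many hyperplanes, which are Lebesgue null and hence null for \<open>gauss\<close>.
    Without ties a maximizer is strict.\<close>
  have "AE c in lborel. \<forall>z\<in>V. \<forall>z'\<in>V - {z}. c \<bullet> z \<noteq> c \<bullet> z'"
  proof (intro AE_finite_allI V(1) finite_Diff)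
    fix z z' assume "z' \<in> V - {z}"
    then have "negligible {c. (z - z') \<bullet> c = 0}" by (intro negligible_hyperplane) auto
    then have "{c. (z - z') \<bullet> c = 0} \<in> null_sets lborel"
      by (auto simp: null_sets_def negligible_iff_null_sets null_sets_completion_iff
          intro!: borel_closed closed_hyperplane)
    from AE_not_in[OF this] show "AE c in lborel. c \<bullet> z \<noteq> c \<bullet> z'"
      by eventually_elim (auto simp: inner_diff_left inner_diff_right inner_commute)
  qed
  then have "AE c in gauss. \<forall>z\<in>V. \<forall>z'\<in>V - {z}. c \<bullet> z \<noteq> c \<bullet> z'"
    unfolding gauss_def by (subst AE_density) (auto elim: eventually_mono)
  then show ?thesis
  proof eventually_elim
    case (elim c)
    obtain z where z: "z \<in> V" "z \<in> Sol_LP (convex hull V) c"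
      using Sol_LP_convex_hull_vertex[OF V] .
    have "c \<bullet> z' < c \<bullet> z" if "z' \<in> V - {z}" for z'
      using that elim z hull_inc[of z' V convex] by (force simp: mem_Sol_LP order_less_le)
    then show ?case using z by (auto simp: opt_cone_def)
  qed
qed

lemma opt_cone_disjoint:
  "disjoint_family_on (opt_cone V) V"
proof -
  have False if "z \<in> V" "z' \<in> V" "z \<noteq> z'" "c \<in> opt_cone V z" "c \<in> opt_cone V z'" for z z' c
  proof -
    have "c \<bullet> z' < c \<bullet> z" "c \<bullet> z < c \<bullet> z'" using that by (auto simp: opt_cone_def)
    then show False by simp
  qed
  then show ?thesis by (auto simp: disjoint_family_on_def)
qed

text \<open>Shifting the cone at \<open>z\<close> by \<open>w z\<close> changes its Gaussian measure by the factor
  \<open>exp (- (x \<bullet> w z) - \<parallel>w z\<parallel>\<^sup>2 / 2)\<close> under the integral; as \<open>w z\<close> lies in the closed cone,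
  the shifted cones remain disjoint and their measures add up.\<close>

lemma gauss_shifted_opt_cones_ge:
  fixes V :: "(real ^ 'n) set"
  assumes V: "finite V" "V \<noteq> {}"
    and w: "\<And>z z'. z \<in> V \<Longrightarrow> z' \<in> V \<Longrightarrow> w z \<bullet> z' \<le> w z \<bullet> z"
    and R: "\<And>z. z \<in> V \<Longrightarrow> norm (w z) \<le> R"
  shows "ennreal (exp (- R\<^sup>2 / 2 - R * sqrt CARD('n)))
    \<le> emeasure gauss (\<Union>z\<in>V. {c. c - w z \<in> opt_cone V z})"
proof -
  note [measurable] = opt_cone_measurable[OF V(1)]
  obtain z0 where "z0 \<in> V" using V by blast
  then have R0: "0 \<le> R" using R[of z0] norm_ge_zero order_trans by blast
  have sub: "{c. c - w z \<in> opt_cone V z} \<subseteq> opt_cone V z" if "z \<in> V" for z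
    using opt_cone_shift[of _ "w z"] w that by blast
  then have disj: "disjoint_family_on (\<lambda>z. {c. c - w z \<in> opt_cone V z}) V"
    using opt_cone_disjoint[of V] unfolding disjoint_family_on_def by blast
  have "exp (- R\<^sup>2 / 2 - R * sqrt CARD('n)) = exp (- R\<^sup>2 / 2) * exp (- R * sqrt CARD('n))"
    by (simp add: exp_add[symmetric])
  then have "ennreal (exp (- R\<^sup>2 / 2 - R * sqrt CARD('n)))
      \<le> ennreal (exp (- R\<^sup>2 / 2)) * (\<integral>\<^sup>+ (x::real^'n). ennreal (exp (- R * norm x)) \<partial>gauss)"
    using nn_integral_gauss_exp_norm_ge[OF R0, where 'n = 'n] by (simp add: ennreal_mult' mult_left_mono)
  \<comment> \<open>The cones partition the space up to a null set, so their indicators sum to 1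
    almost everywhere.\<close>
  also have "(\<integral>\<^sup>+ (x::real^'n). ennreal (exp (- R * norm x)) \<partial>gauss)
      = (\<integral>\<^sup>+ x. (\<Sum>z\<in>V. ennreal (exp (- R * norm x)) * indicator (opt_cone V z) x) \<partial>gauss)"
  proof (intro nn_integral_cong_AE)
    show "AE x in gauss. ennreal (exp (- R * norm x))
        = (\<Sum>z\<in>V. ennreal (exp (- R * norm x)) * indicator (opt_cone V z) x)"
      using AE_gauss_opt_cone[OF V]
    proof eventually_elim
      case (elim x)
      then have "(\<Sum>z\<in>V. indicator (opt_cone V z) x) = (1::ennreal)"
        by (simp add: indicator_UN_disjoint[OF V(1) opt_cone_disjoint, symmetric])
      then show ?case by (simp add: sum_distrib_left[symmetric])
    qed
  qed
  also have "ennreal (exp (- R\<^sup>2 / 2)) * \<dots> = (\<Sum>z\<in>V. \<integral>\<^sup>+ x.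
      ennreal (exp (- R\<^sup>2 / 2 - R * norm x)) * indicator (opt_cone V z) x \<partial>gauss)"
    by (simp add: nn_integral_sum nn_integral_cmult[symmetric] sum_distrib_left
        ennreal_mult'[symmetric] exp_add[symmetric] mult.assoc[symmetric])
  also have "\<dots> \<le> (\<Sum>z\<in>V. emeasure gauss {c. c - w z \<in> opt_cone V z})"
  proof (intro sum_mono)
    fix z assume z: "z \<in> V"
    \<comment> \<open>Cauchy-Schwarz and \<open>norm (w z) \<le> R\<close> bound the Cameron-Martin
      exponent below by a quantity independent of \<open>z\<close>.\<close>
    have "- R\<^sup>2 / 2 - R * norm x \<le> - (x \<bullet> w z) - (norm (w z))\<^sup>2 / 2" for x
    proof -
      have "x \<bullet> w z \<le> norm x * norm (w z)" by (rule norm_cauchy_schwarz)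
      also have "\<dots> \<le> norm x * R" using R[OF z] by (intro mult_left_mono) auto
      finally have "x \<bullet> w z \<le> R * norm x" by (simp add: mult.commute)
      moreover have "(norm (w z))\<^sup>2 \<le> R\<^sup>2" using R[OF z] by (intro power_mono) auto
      ultimately show ?thesis by simp
    qed
    then show "(\<integral>\<^sup>+ x. ennreal (exp (- R\<^sup>2 / 2 - R * norm x)) * indicator (opt_cone V z) x \<partial>gauss)
        \<le> emeasure gauss {c. c - w z \<in> opt_cone V z}"
      by (subst emeasure_gauss_translate)
         (auto intro!: nn_integral_mono mult_right_mono ennreal_leI)
  qed
  also have "\<dots> = emeasure gauss (\<Union>z\<in>V. {c. c - w z \<in> opt_cone V z})"
  proof (rule sum_emeasure[OF _ disj V(1)], safe)
    fix z show "{c. c - w z \<in> opt_cone V z} \<in> sets gauss"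
      unfolding sets_gauss by measurable
  qed
  finally show ?thesis .
qed

lemma std_gaussian_distr:
  assumes "std_gaussian M g"
  shows "g \<in> borel_measurable M" "distr M borel g = gauss"
proof -
  have *: "distributed M lborel g (\<lambda>x. ennreal (gauss_density x))"
    using assms by (simp add: std_gaussian_def gauss_density_def[abs_def])
  show "g \<in> borel_measurable M" using distributed_measurable[OF *] by simp
  show "distr M borel g = gauss"
    using distributed_distr_eq_density[OF *]
    by (simp add: gauss_def cong: distr_cong)
qed

section \<open>The threshold bound\<close>

text \<open>The cutoff \<open>2 * s / B\<close> is where \<open>(t * B)\<^sup>2 / 2\<close> reaches
  \<open>t * B * s\<close>. Up to there the exponent is at least \<open>- k * t\<close>, and the
  primitive at the cutoff contributes \<open>exp (- 4 * s\<^sup>2)\<close>.\<close>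

lemma nn_integral_exp_quadratic_ge:
  assumes B: "0 < B" and s: "0 < s"
  shows "ennreal ((1 - exp (- 4 * s\<^sup>2)) / (2 * B * s))
    \<le> (\<integral>\<^sup>+ t. ennreal (exp (- (t * B)\<^sup>2 / 2 - (t * B) * s)) * indicator {0..} t \<partial>lborel)"
proof -
  define k where "k = 2 * B * s"
  have k: "k > 0" using B s by (simp add: k_def)
  let ?F = "\<lambda>t. - exp (- k * t) / k"
  have "(\<integral>\<^sup>+ t. ennreal (exp (- k * t)) * indicator {0..2 * s / B} t \<partial>lborel)
      = ennreal (?F (2 * s / B) - ?F 0)"
  proof (rule nn_integral_FTC_Icc[where F = ?F])
    show "(?F has_real_derivative exp (- k * t)) (at t)" for t
      using k by (auto intro!: derivative_eq_intros)
  qed (use B s in auto)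
  also have "?F (2 * s / B) - ?F 0 = (1 - exp (- 4 * s\<^sup>2)) / (2 * B * s)"
    using B s by (simp add: k_def field_simps power2_eq_square)
  finally have "ennreal ((1 - exp (- 4 * s\<^sup>2)) / (2 * B * s))
      = (\<integral>\<^sup>+ t. ennreal (exp (- k * t)) * indicator {0..2 * s / B} t \<partial>lborel)" by simp
  also have "\<dots> \<le> (\<integral>\<^sup>+ t. ennreal (exp (- (t * B)\<^sup>2 / 2 - (t * B) * s)) * indicator {0..} t \<partial>lborel)"
  proof (intro nn_integral_mono)
    fix t :: real
    have "- k * t \<le> - (t * B)\<^sup>2 / 2 - (t * B) * s" if t: "0 \<le> t" "t \<le> 2 * s / B"
    proof -
      have "t * B \<le> 2 * s" using t B by (simp add: field_simps)
      then have "(t * B) * (t * B) \<le> (t * B) * (2 * s)"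
        using t B by (intro mult_left_mono) auto
      then show ?thesis by (simp add: k_def power2_eq_square algebra_simps)
    qed
    then show "ennreal (exp (- k * t)) * indicator {0..2 * s / B} t
        \<le> ennreal (exp (- (t * B)\<^sup>2 / 2 - (t * B) * s)) * indicator {0..} t"
      by (auto simp: indicator_def intro!: ennreal_leI)
  qed
  finally show ?thesis .
qed

text \<open>Only a lower integral is bounded, so \<open>T\<close> need not be measurable.\<close>

lemma nn_integral_ge_tail:
  assumes "prob_space M"
    and E: "Measurable.pred (M \<Otimes>\<^sub>M lborel) (\<lambda>(\<omega>, t). E t \<omega>)"
    and T: "\<And>t \<omega>. \<omega> \<in> space M \<Longrightarrow> 0 \<le> t \<Longrightarrow> E t \<omega> \<Longrightarrow> ennreal t \<le> T \<omega>"
  shows "(\<integral>\<^sup>+ t. emeasure M {\<omega> \<in> space M. E t \<omega>} * indicator {0..} t \<partial>lborel) \<le> (\<integral>\<^sup>+ \<omega>. T \<omega> \<partial>M)"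
proof -
  interpret prob_space M by fact
  interpret pair_sigma_finite M lborel ..
  note [measurable] = E
  \<comment> \<open>Indicator of the region to which Fubini is applied: its slices at fixed
    \<open>t\<close> have the tail probabilities as measure, and its slice at fixed
    \<open>\<omega>\<close> lies below \<open>T \<omega>\<close>.\<close>
  define f :: "_ \<times> real \<Rightarrow> ennreal"
    where "f = indicator {x \<in> space (M \<Otimes>\<^sub>M lborel). 0 \<le> snd x \<and> (case x of (\<omega>, t) \<Rightarrow> E t \<omega>)}"
  have f [measurable]: "f \<in> borel_measurable (M \<Otimes>\<^sub>M lborel)"
    unfolding f_def by measurable
  have "(\<integral>\<^sup>+ t. emeasure M {\<omega> \<in> space M. E t \<omega>} * indicator {0..} t \<partial>lborel)
      = (\<integral>\<^sup>+ t. (\<integral>\<^sup>+ \<omega>. f (\<omega>, t) \<partial>M) \<partial>lborel)"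
  proof (intro nn_integral_cong)
    fix t :: real
    have [measurable]: "Measurable.pred M (E t)"
      using measurable_compose[OF measurable_Pair2'[of t lborel M] E] by simp
    have "(\<integral>\<^sup>+ \<omega>. f (\<omega>, t) \<partial>M) = (\<integral>\<^sup>+ \<omega>. indicator {\<omega> \<in> space M. E t \<omega>} \<omega> * indicator {0..} t \<partial>M)"
      by (intro nn_integral_cong) (auto simp: f_def indicator_def space_pair_measure)
    also have "\<dots> = emeasure M {\<omega> \<in> space M. E t \<omega>} * indicator {0..} t"
      by (subst nn_integral_multc) auto
    finally show "emeasure M {\<omega> \<in> space M. E t \<omega>} * indicator {0..} t = (\<integral>\<^sup>+ \<omega>. f (\<omega>, t) \<partial>M)"
      by simp
  qed
  also have "\<dots> = (\<integral>\<^sup>+ \<omega>. (\<integral>\<^sup>+ t. f (\<omega>, t) \<partial>lborel) \<partial>M)"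
    by (rule Fubini[OF f])
  also have "\<dots> \<le> (\<integral>\<^sup>+ \<omega>. T \<omega> \<partial>M)"
  proof (intro nn_integral_mono)
    fix \<omega> assume \<omega>: "\<omega> \<in> space M"
    show "(\<integral>\<^sup>+ t. f (\<omega>, t) \<partial>lborel) \<le> T \<omega>"
    proof (cases "T \<omega>")
      case (real r)
      have "(\<integral>\<^sup>+ t. f (\<omega>, t) \<partial>lborel) \<le> (\<integral>\<^sup>+ t. indicator {0..r} t \<partial>lborel)"
        using T[OF \<omega>] real by (intro nn_integral_mono) (auto simp: f_def indicator_def)
      also have "\<dots> = T \<omega>" using real by simp
      finally show ?thesis .
    qed simp
  qed
  finally show ?thesis .
qed

lemma polyhedron_matrix_le: "polyhedron {x. (A :: real^'n^'m) *v x \<le> b}"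
proof -
  have "{x. A *v x \<le> b} = \<Inter> ((\<lambda>i. {x. row i A \<bullet> x \<le> b $ i}) ` UNIV)"
    by (auto simp: less_eq_vec_def matrix_vector_mul_component row_def)
  also have "polyhedron \<dots>"
    by (intro polyhedron_Inter) (auto simp: polyhedron_halfspace_le)
  finally show ?thesis .
qed

theorem corollary2p2:
  fixes A :: "real ^ 'n ^ 'm" and b :: "real ^ 'm"
    and Q :: "(real ^ 'n) set"
    and \<psi> :: "real ^ 'n \<Rightarrow> ereal"
    and \<epsilon> B :: real
    and v :: "real ^ 'n \<Rightarrow> real ^ 'n"
    and M :: "'w measure"
    and g :: "'w \<Rightarrow> real ^ 'n"
  assumes Q: "Q = {x. A *v x \<le> b}" "bounded Q" "Q \<noteq> {}"
    and psi: "proper_fun \<psi>" "convex_fun \<psi>" "rel_interior (eff_dom \<psi>) \<inter> Q \<noteq> {}"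
    and eps: "0 \<le> \<epsilon>"
    and nonempty: "\<forall>z\<in>vert Q. subdiff \<psi> z \<inter> normal_cone Q z \<noteq> {}"
    and v: "\<forall>z\<in>vert Q. v z \<in> subdiff \<psi> z \<inter> normal_cone Q z"
    and B: "B = Max ((\<lambda>z. norm (v z)) ` vert Q)"
    and M: "prob_space M"
    and g: "std_gaussian M g"
  shows "ER M Q \<psi> g \<epsilon> \<in> sets M \<and>
    measure M (space M - ER M Q \<psi> g \<epsilon>)
      \<le> 1 - exp (- (1/2) * \<epsilon>\<^sup>2 * B\<^sup>2 - \<epsilon> * B * sqrt (real CARD('n))) \<and>
    1 - exp (- (1/2) * \<epsilon>\<^sup>2 * B\<^sup>2 - \<epsilon> * B * sqrt (real CARD('n)))
      \<le> (1/2) * \<epsilon>\<^sup>2 * B\<^sup>2 + \<epsilon> * B * sqrt (real CARD('n)) \<and>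
    (if B = 0 then \<infinity>
     else ennreal ((1 - exp (- 4 * real CARD('n))) / (2 * B * sqrt (real CARD('n)))))
      \<le> (\<integral>\<^sup>+ \<omega>. threshold Q \<psi> (g \<omega>) \<partial>M)"
proof -
  interpret prob_space M by fact

  \<comment> \<open>The vertices of the polytope\<close>
  define V where "V = vert Q"
  define s where "s = sqrt (real CARD('n))"
  have s: "0 < s" "s\<^sup>2 = CARD('n)" by (auto simp: s_def)
  have poly: "polyhedron Q" unfolding Q(1) by (rule polyhedron_matrix_le)
  then have "compact Q" "convex Q"
    using Q(2) by (auto simp: compact_eq_bounded_closed polyhedron_imp_closed polyhedron_imp_convex)
  then have hull: "Q = convex hull V"
    unfolding V_def vert_def by (rule Krein_Milman_Minkowski)
  have "finite V"
    using finite_polyhedron_extreme_points[OF poly] by (simp add: V_def vert_def)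
  moreover have "V \<noteq> {}" using Q(3) hull convex_hull_empty by metis
  ultimately have V: "finite V" "V \<noteq> {}" .
  note [measurable] = opt_cone_measurable[OF V(1)]
  have vz: "v z \<in> subdiff \<psi> z" "\<And>y. y \<in> Q \<Longrightarrow> v z \<bullet> y \<le> v z \<bullet> z" "norm (v z) \<le> B"
    if "z \<in> V" for z
    using v that V(1) unfolding V_def
    by (auto simp: normal_cone_def inner_diff_right B)
  have B0: "0 \<le> B" using V(2) vz(3) norm_ge_zero order_trans by blast
  have VQ: "z \<in> Q" if "z \<in> V" for z using that hull hull_inc by metis
  note [measurable] = std_gaussian_distr(1)[OF g]

  \<comment> \<open>Shifted cones and exactness\<close>
  define D where "D t = (\<Union>z\<in>V. {c. c - t *\<^sub>R v z \<in> opt_cone V z})" for t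
  have D_meas: "D t \<in> sets borel" for t
    unfolding D_def using V(1) by (intro sets.finite_UN) measurable
  \<comment> \<open>Both properties of \<open>v z\<close> enter: normality keeps the unshifted cost
    in the cone, and the subgradient inequality gives optimality in the regularized program.\<close>
  have exact: "Sol_LP Q c = {z} \<and> z \<in> Sol_P Q \<psi> t c"
    if z: "z \<in> V" and c: "c - t *\<^sub>R v z \<in> opt_cone V z" and t: "0 \<le> t" for c t z
  proof
    show "Sol_LP Q c = {z}"
      unfolding hull
      using vz(2)[OF z VQ] t
      by (intro Sol_LP_opt_cone z opt_cone_shift[OF c]) (auto intro!: mult_left_mono)
    show "z \<in> Sol_P Q \<psi> t c"
      using Sol_LP_opt_cone[OF z c] psi(1) vz(1)[OF z] t
      by (intro Sol_P_if_shifted_normal) (auto simp: hull)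
  qed
  have prob_D: "ennreal (exp (- (t * B)\<^sup>2 / 2 - (t * B) * s)) \<le> emeasure M {\<omega> \<in> space M. g \<omega> \<in> D t}"
    if t: "0 \<le> t" for t
  proof -
    \<comment> \<open>Here the shift is \<open>t *\<^sub>R v z\<close> and the radius is
      \<open>t * B\<close>.\<close>
    have "ennreal (exp (- (t * B)\<^sup>2 / 2 - (t * B) * s)) \<le> emeasure gauss (D t)"
      unfolding D_def s_def
      using vz VQ t by (intro gauss_shifted_opt_cones_ge V) (auto intro!: mult_left_mono)
    also have "\<dots> = emeasure M {\<omega> \<in> space M. g \<omega> \<in> D t}"
      using D_meas[of t] by (subst std_gaussian_distr(2)[OF g, symmetric])
        (auto simp: emeasure_distr vimage_def Int_def conj_commute)
    finally show ?thesis .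
  qed

  \<comment> \<open>The probability of exactness\<close>
  have ER: "ER M Q \<psi> g \<epsilon> \<in> sets M"
  proof -
    have "{c. z \<in> Sol_P Q \<psi> \<epsilon> c} \<in> sets borel" if "z \<in> V" for z
      using subdiff_finite[OF psi(1) vz(1)[OF that]] closed_Sol_P_coeffs[OF psi(1) _ eps]
      by (metis borel_closed)
    then have "(\<Union>z\<in>V. opt_cone V z \<inter> {c. z \<in> Sol_P Q \<psi> \<epsilon> c}) \<in> sets borel"
      using V(1) by (intro sets.finite_UN sets.Int) auto
    then show ?thesis
      unfolding hull ER_eq_vimage[OF V] by (rule measurable_sets[OF std_gaussian_distr(1)[OF g]])
  qed
  have "{\<omega> \<in> space M. g \<omega> \<in> D \<epsilon>} \<subseteq> ER M Q \<psi> g \<epsilon>"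
    using exact eps by (fastforce simp: D_def ER_def)
  then have "emeasure M {\<omega> \<in> space M. g \<omega> \<in> D \<epsilon>} \<le> emeasure M (ER M Q \<psi> g \<epsilon>)"
    by (intro emeasure_mono ER)
  with prob_D[OF eps] have "ennreal (exp (- (\<epsilon> * B)\<^sup>2 / 2 - (\<epsilon> * B) * s)) \<le> emeasure M (ER M Q \<psi> g \<epsilon>)"
    by (rule order_trans)
  then have "exp (- (\<epsilon> * B)\<^sup>2 / 2 - (\<epsilon> * B) * s) \<le> prob (ER M Q \<psi> g \<epsilon>)"
    by (simp add: emeasure_eq_measure)
  then have bound: "measure M (space M - ER M Q \<psi> g \<epsilon>)
      \<le> 1 - exp (- (1/2) * \<epsilon>\<^sup>2 * B\<^sup>2 - \<epsilon> * B * s)"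
    by (simp add: prob_compl[OF ER] power_mult_distrib)

  \<comment> \<open>The expected threshold\<close>
  have "(\<integral>\<^sup>+ t. ennreal (exp (- (t * B)\<^sup>2 / 2 - (t * B) * s)) * indicator {0..} t \<partial>lborel)
      \<le> (\<integral>\<^sup>+ t. emeasure M {\<omega> \<in> space M. g \<omega> \<in> D t} * indicator {0..} t \<partial>lborel)"
    using prob_D by (intro nn_integral_mono) (auto simp: indicator_def)
  also have "\<dots> \<le> (\<integral>\<^sup>+ \<omega>. threshold Q \<psi> (g \<omega>) \<partial>M)"
  \<comment> \<open>\<open>g \<omega> \<in> D t\<close> stands in for exactness at \<open>t\<close>:
    it implies exactness and, as a finite union of Borel conditions on
    \<open>g \<omega> - t *\<^sub>R v z\<close>, is jointly measurable in \<open>\<omega>\<close>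
    and \<open>t\<close>.\<close>
  proof (rule nn_integral_ge_tail[OF M])
    show "Measurable.pred (M \<Otimes>\<^sub>M lborel) (\<lambda>(\<omega>, t). g \<omega> \<in> D t)"
      using V(1) unfolding D_def UN_iff mem_Collect_eq by measurable
    show "ennreal t \<le> threshold Q \<psi> (g \<omega>)" if t: "0 \<le> t" and c: "g \<omega> \<in> D t" for t \<omega>
    proof -
      obtain z where z: "z \<in> V" "g \<omega> - t *\<^sub>R v z \<in> opt_cone V z" using c by (auto simp: D_def)
      obtain p where "\<psi> z = ereal p" using subdiff_finite[OF psi(1) vz(1)[OF z(1)]] .
      then show ?thesis using exact[OF z t] t psi(1) threshold_ge_if_exact by blast
    qed
  qed
  finally have tail: "(\<integral>\<^sup>+ t. ennreal (exp (- (t * B)\<^sup>2 / 2 - (t * B) * s)) * indicator {0..} t \<partial>lborel)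
      \<le> (\<integral>\<^sup>+ \<omega>. threshold Q \<psi> (g \<omega>) \<partial>M)" .
  have "(if B = 0 then \<infinity> else ennreal ((1 - exp (- 4 * real CARD('n))) / (2 * B * s)))
      \<le> (\<integral>\<^sup>+ \<omega>. threshold Q \<psi> (g \<omega>) \<partial>M)"
  proof (cases "B = 0")
    case True
    \<comment> \<open>For \<open>B = 0\<close> the integrand in \<open>tail\<close> is constantly 1
      on the half-line, whose Lebesgue measure is infinite.\<close>
    have "emeasure lborel {0::real..} = \<infinity>"
    proof (cases "emeasure lborel {0::real..}")
      case (real r)
      have "emeasure lborel {0..r + 1} \<le> emeasure lborel {0::real..}"
        by (intro emeasure_mono) auto
      then show ?thesis using real by (simp add: ennreal_le_iff del: ennreal_plus)
    qed simp
    then show ?thesis using tail True by simp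
  next
    case False
    then show ?thesis
      using order_trans[OF nn_integral_exp_quadratic_ge tail] B0 s by simp
  qed
  moreover have "1 - exp (- (1/2) * \<epsilon>\<^sup>2 * B\<^sup>2 - \<epsilon> * B * s) \<le> (1/2) * \<epsilon>\<^sup>2 * B\<^sup>2 + \<epsilon> * B * s"
    using exp_ge_add_one_self[of "- (1/2) * \<epsilon>\<^sup>2 * B\<^sup>2 - \<epsilon> * B * s"] by linarith
  ultimately show ?thesis using ER bound unfolding s_def by blast
qed

end
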